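(* There exist a finite-dimensional inner product vector space $(E,g)$ over $k$ ($k=\mathbb R$ or $\mathbb C$), an endomorphism $f\in\operatorname{End}_k(E)$ and $f$-invariant subspaces $\mathcal H_f=\{H_1,\dots,H_n\}$ with $E=H_1\oplus\dots\oplus H_n$ such that $f^+_{\mathcal H_f}\ne f^\dagger$.
   Context: For an endomorphism $h$ of a finite-dimensional inner product space $H$, its Moore-Penrose inverse $h^\dagger$ is the linear map equal to $(h|_{[\operatorname{Ker} h]^\perp})^{-1}$ on $\operatorname{Im} h$ and $0$ on $[\operatorname{Im} h]^\perp$. With $f_i=f|_{H_i}$ and $H_i$ carrying the restricted inner product, $f^+_{\mathcal H_f}$ is the unique endomorphism of $E$ with $f^+_{\mathcal H_f}|_{H_i}=f_i^\dagger$ for each $i$. *)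

theory Defs
  imports "Jordan_Normal_Form.Matrix" "Jordan_Normal_Form.Conjugate"
begin

text \<open>The space E is modelled (up to isometry) as carrier_vec n with an arbitrary
  inner product g (linear in the first argument, conjugate symmetric, positive definite).
  Scalars: any conjugatable ordered field; used with real and complex (complex
  order = HOL-Library Complex_Order, so 0 < z means z real and positive).\<close>

definition inner_prod_on :: "nat \<Rightarrow> ('k::conjugatable_ordered_field vec \<Rightarrow> 'k vec \<Rightarrow> 'k) \<Rightarrow> bool" where
  "inner_prod_on n g \<longleftrightarrow>
     (\<forall>x\<in>carrier_vec n. \<forall>y\<in>carrier_vec n. \<forall>z\<in>carrier_vec n. g (x + y) z = g x z + g y z) \<and>
     (\<forall>x\<in>carrier_vec n. \<forall>y\<in>carrier_vec n. \<forall>c. g (c \<cdot>\<^sub>v x) y = c * g x y) \<and>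
     (\<forall>x\<in>carrier_vec n. \<forall>y\<in>carrier_vec n. g y x = conjugate (g x y)) \<and>
     (\<forall>x\<in>carrier_vec n. x \<noteq> 0\<^sub>v n \<longrightarrow> 0 < g x x)"

definition is_subspace :: "nat \<Rightarrow> 'k::field vec set \<Rightarrow> bool" where
  "is_subspace n H \<longleftrightarrow> H \<subseteq> carrier_vec n \<and> 0\<^sub>v n \<in> H \<and>
     (\<forall>x\<in>H. \<forall>y\<in>H. x + y \<in> H) \<and> (\<forall>x\<in>H. \<forall>c. c \<cdot>\<^sub>v x \<in> H)"

definition vec_sum :: "nat \<Rightarrow> (nat \<Rightarrow> 'k::field vec) \<Rightarrow> nat \<Rightarrow> 'k vec" where
  "vec_sum n hs m = foldr (\<lambda>i acc. hs i + acc) [0..<m] (0\<^sub>v n)"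

text \<open>E = H_0 \<oplus> ... \<oplus> H_(m-1): every vector is uniquely a sum of components.\<close>
definition is_direct_sum :: "nat \<Rightarrow> nat \<Rightarrow> (nat \<Rightarrow> 'k::field vec set) \<Rightarrow> bool" where
  "is_direct_sum n m H \<longleftrightarrow>
     (\<forall>x\<in>carrier_vec n. \<exists>!hs. (\<forall>i<m. hs i \<in> H i) \<and> (\<forall>i. m \<le> i \<longrightarrow> hs i = 0\<^sub>v n) \<and>
        x = vec_sum n hs m)"

definition invariant_under :: "'k::field mat \<Rightarrow> 'k vec set \<Rightarrow> bool" where
  "invariant_under A H \<longleftrightarrow> (\<forall>x\<in>H. A *\<^sub>v x \<in> H)"

text \<open>Moore-Penrose inverse h' of an endomorphism h of the subspace H (with the
  restricted inner product g): h' is linear on H, maps H to H, equals the inverse of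
  h restricted to (Ker h)^perp on Im h, and is 0 on (Im h)^perp (complements in H).\<close>
definition is_mp_inverse ::
  "nat \<Rightarrow> ('k::conjugatable_ordered_field vec \<Rightarrow> 'k vec \<Rightarrow> 'k) \<Rightarrow> 'k vec set \<Rightarrow>
   ('k vec \<Rightarrow> 'k vec) \<Rightarrow> ('k vec \<Rightarrow> 'k vec) \<Rightarrow> bool" where
  "is_mp_inverse n g H h h' \<longleftrightarrow>
     (\<forall>x\<in>H. h' x \<in> H) \<and>
     (\<forall>x\<in>H. \<forall>y\<in>H. h' (x + y) = h' x + h' y) \<and>
     (\<forall>x\<in>H. \<forall>c. h' (c \<cdot>\<^sub>v x) = c \<cdot>\<^sub>v h' x) \<and>
     (\<forall>y\<in>h ` H. (\<forall>z\<in>{x\<in>H. h x = 0\<^sub>v n}. g (h' y) z = 0) \<and> h (h' y) = y) \<and>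
     (\<forall>y\<in>H. (\<forall>z\<in>h ` H. g y z = 0) \<longrightarrow> h' y = 0\<^sub>v n)"

end

theory Submission
  imports Defs
begin

text \<open>On k^2 with the standard inner product, let f x = (x \<bullet>c v) u be the rank-one map with
  u = e1 and v = e1 - e2. It fixes the line k u and kills the line k (e1 + e2); these f-invariant
  lines are complementary but not orthogonal. On each line the Moore-Penrose inverse of f is f
  itself (the inverse of the identity, resp. zero), so the blockwise inverse is f. The global
  Moore-Penrose inverse of a rank-one map, y \<mapsto> (y \<bullet>c u) v / (|u|^2 |v|^2), vanishes on
  (Im f)^perp = k e2, whereas f e2 = -e1.\<close>

lemma zero_smult_vec [simp]: "(v :: 'a::semiring_0 vec) \<in> carrier_vec n \<Longrightarrow> 0 \<cdot>\<^sub>v v = 0\<^sub>v n"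
  by (intro eq_vecI) auto

lemma conjugate_one [simp]: "conjugate (1 :: 'a::conjugatable_field) = 1"
proof -
  have "conjugate (1::'a) = conjugate 1 * conjugate 1"
    using conjugate_dist_mul[of 1 1] by (metis mult_1)
  then show ?thesis
    by (metis conjugate_zero_iff mult_cancel_left1 one_neq_zero)
qed

lemma smult_vec_eq_0D:
  fixes u :: "'a::field vec"
  assumes "a \<cdot>\<^sub>v u = 0\<^sub>v n" "u \<noteq> 0\<^sub>v n"
  shows "a = 0"
proof (rule ccontr)
  assume "a \<noteq> 0"
  then have "u = inverse a \<cdot>\<^sub>v (a \<cdot>\<^sub>v u)" by (simp add: smult_smult_assoc)
  then show False using assms by auto
qed

lemma cscalar_prod_smult_right:
  fixes x y :: "'a::{conjugatable_ring, comm_ring} vec"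
  assumes "x \<in> carrier_vec n" "y \<in> carrier_vec n"
  shows "x \<bullet>c (a \<cdot>\<^sub>v y) = conjugate a * (x \<bullet>c y)"
  using assms by (simp add: conjugate_smult_vec)

lemma inner_prod_on_cscalar_prod:
  "inner_prod_on n ((\<bullet>c) :: 'k::conjugatable_ordered_field vec \<Rightarrow> 'k vec \<Rightarrow> 'k)"
  unfolding inner_prod_on_def
proof (intro conjI ballI allI impI)
  fix x y z :: "'k vec"
  assume "x \<in> carrier_vec n" "y \<in> carrier_vec n" "z \<in> carrier_vec n"
  then show "(x + y) \<bullet>c z = x \<bullet>c z + y \<bullet>c z"
    by (simp add: add_scalar_prod_distrib[of _ n])
next
  fix x y :: "'k vec" and c :: 'k
  assume "x \<in> carrier_vec n" "y \<in> carrier_vec n"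
  then show "(c \<cdot>\<^sub>v x) \<bullet>c y = c * (x \<bullet>c y)" by simp
next
  fix x y :: "'k vec"
  assume "x \<in> carrier_vec n" "y \<in> carrier_vec n"
  then show "y \<bullet>c x = conjugate (x \<bullet>c y)"
    by (simp add: conjugate_sprod_vec[of _ n] comm_scalar_prod[of _ n])
next
  fix x :: "'k vec"
  assume "x \<in> carrier_vec n" "x \<noteq> 0\<^sub>v n"
  then show "0 < x \<bullet>c x" by simp
qed

lemma inner_prod_on_zero_left:
  fixes g :: "'k::conjugatable_ordered_field vec \<Rightarrow> 'k vec \<Rightarrow> 'k"
  assumes "inner_prod_on n g" "z \<in> carrier_vec n"
  shows "g (0\<^sub>v n) z = 0"
proof -
  have "g (0 \<cdot>\<^sub>v 0\<^sub>v n) z = 0 * g (0\<^sub>v n) z"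
    using assms zero_carrier_vec unfolding inner_prod_on_def by blast
  moreover have "0 \<cdot>\<^sub>v 0\<^sub>v n = (0\<^sub>v n :: 'k vec)"
    by simp
  ultimately show ?thesis
    by simp
qed

lemma inner_prod_on_zero_right:
  assumes "inner_prod_on n g" "x \<in> carrier_vec n"
  shows "g x (0\<^sub>v n) = 0"
proof -
  have "g x (0\<^sub>v n) = conjugate (g (0\<^sub>v n) x)"
    using assms zero_carrier_vec unfolding inner_prod_on_def by blast
  then show ?thesis
    by (simp add: inner_prod_on_zero_left[OF assms])
qed

lemma inner_prod_on_self_eq_0D:
  assumes "inner_prod_on n g" "x \<in> carrier_vec n" "g x x = 0"
  shows "x = 0\<^sub>v n"
  using assms unfolding inner_prod_on_def by (metis less_irrefl)

lemma is_mp_inverse_self_if_identity_on: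
  assumes g: "inner_prod_on n g" and H: "is_subspace n H" and id: "\<forall>x\<in>H. h x = x"
  shows "is_mp_inverse n g H h h"
  unfolding is_mp_inverse_def
proof (intro conjI ballI allI impI)
  fix y z assume "y \<in> h ` H" "z \<in> {x \<in> H. h x = 0\<^sub>v n}"
  then show "g (h y) z = 0"
    using H id inner_prod_on_zero_right[OF g] by (auto simp: is_subspace_def)
next
  fix y assume y: "y \<in> H" and "\<forall>z\<in>h ` H. g y z = 0"
  then have "g y y = 0" using id by (metis image_eqI)
  then show "h y = 0\<^sub>v n"
    using inner_prod_on_self_eq_0D[OF g] y H id by (auto simp: is_subspace_def)
qed (use H id in \<open>auto simp: is_subspace_def\<close>)

lemma is_mp_inverse_if_zero_on:
  assumes g: "inner_prod_on n g" and H: "is_subspace n H"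
    and h: "\<forall>x\<in>H. h x = 0\<^sub>v n" and h': "\<forall>x\<in>H. h' x = 0\<^sub>v n"
  shows "is_mp_inverse n g H h h'"
  unfolding is_mp_inverse_def
proof (intro conjI ballI allI impI)
  fix y z assume "y \<in> h ` H" "z \<in> {x \<in> H. h x = 0\<^sub>v n}"
  then show "g (h' y) z = 0"
    using H h h' inner_prod_on_zero_left[OF g] by (auto simp: is_subspace_def)
qed (use H h h' in \<open>auto simp: is_subspace_def\<close>)

definition rank_one_mat :: "nat \<Rightarrow> 'a::conjugatable_ring vec \<Rightarrow> 'a vec \<Rightarrow> 'a mat" where
  "rank_one_mat n u v = mat n n (\<lambda>(i, j). u $ i * conjugate (v $ j))"

lemma rank_one_mat_carrier [simp]: "rank_one_mat n u v \<in> carrier_mat n n"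
  by (simp add: rank_one_mat_def)

lemma rank_one_mat_mult_vec:
  fixes u v x :: "'a::{conjugatable_ring, comm_ring} vec"
  assumes "u \<in> carrier_vec n" "v \<in> carrier_vec n" "x \<in> carrier_vec n"
  shows "rank_one_mat n u v *\<^sub>v x = (x \<bullet>c v) \<cdot>\<^sub>v u"
  using assms
  by (intro eq_vecI) (auto simp: rank_one_mat_def scalar_prod_def row_def sum_distrib_left ac_simps)

text \<open>The range is k u and the kernel is the orthogonal complement of v, so the inverse must map
  k u into k v and vanish on the orthogonal complement of u; the factor c makes it a right inverse.\<close>
lemma is_mp_inverse_rank_one_mat:
  fixes u v :: "'k::conjugatable_ordered_field vec"
  assumes u: "u \<in> carrier_vec n" "u \<noteq> 0\<^sub>v n" and v: "v \<in> carrier_vec n" "v \<noteq> 0\<^sub>v n"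
  defines "c \<equiv> 1 / ((u \<bullet>c u) * (v \<bullet>c v))"
  shows "is_mp_inverse n (\<bullet>c) (carrier_vec n)
           ((*\<^sub>v) (rank_one_mat n u v)) ((*\<^sub>v) (rank_one_mat n (c \<cdot>\<^sub>v v) u))"
proof -
  let ?A = "rank_one_mat n u v" and ?D = "rank_one_mat n (c \<cdot>\<^sub>v v) u"
  have cv: "c \<cdot>\<^sub>v v \<in> carrier_vec n" using v by simp
  have uu: "u \<bullet>c u \<noteq> 0" and vv: "v \<bullet>c v \<noteq> 0"
    using u v conjugate_square_greater_0_vec by (metis less_irrefl)+
  have A: "?A *\<^sub>v x = (x \<bullet>c v) \<cdot>\<^sub>v u" if "x \<in> carrier_vec n" for x
    using rank_one_mat_mult_vec u v that by blast
  have D: "?D *\<^sub>v y = (y \<bullet>c u) \<cdot>\<^sub>v (c \<cdot>\<^sub>v v)" if "y \<in> carrier_vec n" for y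
    using rank_one_mat_mult_vec u cv that by blast
  show ?thesis
    unfolding is_mp_inverse_def
  proof (intro conjI ballI allI impI)
    fix y z assume "y \<in> (*\<^sub>v) ?A ` carrier_vec n" "z \<in> {x \<in> carrier_vec n. ?A *\<^sub>v x = 0\<^sub>v n}"
    then have y: "y \<in> carrier_vec n" and z: "z \<in> carrier_vec n" "z \<bullet>c v = 0"
      using A u smult_vec_eq_0D by auto
    have "v \<bullet>c z = conjugate (z \<bullet>c v)"
      using inner_prod_on_cscalar_prod z v unfolding inner_prod_on_def by blast
    then show "(?D *\<^sub>v y) \<bullet>c z = 0"
      using D y z v by simp
  next
    fix y assume "y \<in> (*\<^sub>v) ?A ` carrier_vec n"
    then obtain x where x: "x \<in> carrier_vec n" and y: "y = (x \<bullet>c v) \<cdot>\<^sub>v u"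
      using A by auto
    have "?D *\<^sub>v y \<in> carrier_vec n"
      using D x y u cv by simp
    then have "?A *\<^sub>v (?D *\<^sub>v y) = ((?D *\<^sub>v y) \<bullet>c v) \<cdot>\<^sub>v u"
      by (rule A)
    also have "(?D *\<^sub>v y) \<bullet>c v = x \<bullet>c v"
      using D x y u v uu vv by (simp add: c_def)
    finally show "?A *\<^sub>v (?D *\<^sub>v y) = y"
      using y by simp
  next
    fix y assume y: "y \<in> carrier_vec n" and orth: "\<forall>z\<in>(*\<^sub>v) ?A ` carrier_vec n. y \<bullet>c z = 0"
    have "y \<bullet>c ((v \<bullet>c v) \<cdot>\<^sub>v u) = 0"
      using orth A v by (metis image_eqI)
    then have "y \<bullet>c u = 0"
      using cscalar_prod_smult_right[OF y u(1), of "v \<bullet>c v"] vv by simp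
    then show "?D *\<^sub>v y = 0\<^sub>v n"
      using D y cv by auto
  qed (use v cv in \<open>auto simp: D mult_add_distrib_mat_vec[of _ n n] mult_mat_vec[of _ n n]\<close>)
qed

definition vec_line :: "'a::field vec \<Rightarrow> 'a vec set" where
  "vec_line u = range (\<lambda>c. c \<cdot>\<^sub>v u)"

lemma is_subspace_vec_line:
  assumes "u \<in> carrier_vec n"
  shows "is_subspace n (vec_line u)"
  unfolding is_subspace_def vec_line_def
proof (intro conjI ballI allI)
  show "0\<^sub>v n \<in> range (\<lambda>c. c \<cdot>\<^sub>v u)"
    using assms by (intro range_eqI[where x = 0]) auto
  fix x y assume "x \<in> range (\<lambda>c. c \<cdot>\<^sub>v u)" "y \<in> range (\<lambda>c. c \<cdot>\<^sub>v u)"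
  then obtain a b where "x = a \<cdot>\<^sub>v u" "y = b \<cdot>\<^sub>v u" by auto
  then show "x + y \<in> range (\<lambda>c. c \<cdot>\<^sub>v u)"
    by (intro range_eqI[where x = "a + b"]) (simp add: add_smult_distrib_vec)
qed (use assms in \<open>auto simp: smult_smult_assoc\<close>)

lemma mult_mat_vec_vec_line:
  assumes "A \<in> carrier_mat n n" "u \<in> carrier_vec n" "A *\<^sub>v u = a \<cdot>\<^sub>v u" "x \<in> vec_line u"
  shows "A *\<^sub>v x = a \<cdot>\<^sub>v x"
  using assms by (auto simp: vec_line_def mult_mat_vec smult_smult_assoc mult.commute)

lemma vec_sum_2: "hs 1 \<in> carrier_vec n \<Longrightarrow> vec_sum n hs 2 = hs 0 + hs 1"
  by (simp add: vec_sum_def numeral_2_eq_2)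

lemma subspace_decomposition_unique:
  assumes H0: "is_subspace n H0" and H1: "is_subspace n H1" and trivial: "H0 \<inter> H1 \<subseteq> {0\<^sub>v n}"
    and in_H0: "a \<in> H0" "a' \<in> H0" and in_H1: "b \<in> H1" "b' \<in> H1" and eq: "a' + b' = a + b"
  shows "a' = a \<and> b' = b"
proof -
  have vecs: "a \<in> carrier_vec n" "b \<in> carrier_vec n" "a' \<in> carrier_vec n" "b' \<in> carrier_vec n"
    using H0 H1 in_H0 in_H1 by (auto simp: is_subspace_def)
  have comp: "a' $ i + b' $ i = a $ i + b $ i" if "i < n" for i
    using arg_cong[OF eq, of "\<lambda>x. x $ i"] that vecs by simp
  have "a' + (-1) \<cdot>\<^sub>v a = b + (-1) \<cdot>\<^sub>v b'"
  proof (rule eq_vecI)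
    fix i assume "i < dim_vec (b + (-1) \<cdot>\<^sub>v b')"
    then show "(a' + (-1) \<cdot>\<^sub>v a) $ i = (b + (-1) \<cdot>\<^sub>v b') $ i"
      using comp[of i] vecs by (simp add: algebra_simps diff_eq_eq eq_diff_eq)
  qed (use vecs in simp)
  moreover have "a' + (-1) \<cdot>\<^sub>v a \<in> H0" "b + (-1) \<cdot>\<^sub>v b' \<in> H1"
    using H0 H1 in_H0 in_H1 by (auto simp: is_subspace_def)
  ultimately have "a' + (-1) \<cdot>\<^sub>v a = 0\<^sub>v n"
    using trivial by auto
  then have "a' = a"
    using vecs by (auto simp: vec_eq_iff dest: arg_cong[of _ _ "\<lambda>x. x $ _"])
  then show ?thesis
    using comp vecs by (auto simp: vec_eq_iff)
qed

lemma is_direct_sum_2I: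
  assumes H0: "is_subspace n H0" and H1: "is_subspace n H1" and trivial: "H0 \<inter> H1 \<subseteq> {0\<^sub>v n}"
    and spans: "\<forall>x\<in>carrier_vec n. \<exists>a\<in>H0. \<exists>b\<in>H1. x = a + b"
  shows "is_direct_sum n 2 (\<lambda>i. if i = 0 then H0 else H1)"
  unfolding is_direct_sum_def
proof
  fix x :: "'a vec" assume "x \<in> carrier_vec n"
  then obtain a b where a: "a \<in> H0" and b: "b \<in> H1" and x: "x = a + b"
    using spans by blast
  have H1_carrier: "H1 \<subseteq> carrier_vec n"
    using H1 by (simp add: is_subspace_def)
  let ?hs = "\<lambda>i::nat. if i = 0 then a else if i = 1 then b else 0\<^sub>v n"
  show "\<exists>!hs. (\<forall>i<2. hs i \<in> (if i = 0 then H0 else H1)) \<and> (\<forall>i. 2 \<le> i \<longrightarrow> hs i = 0\<^sub>v n)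
          \<and> x = vec_sum n hs 2"
  proof (rule ex1I[of _ ?hs])
    fix hs assume hs: "(\<forall>i<2. hs i \<in> (if i = 0 then H0 else H1)) \<and> (\<forall>i. 2 \<le> i \<longrightarrow> hs i = 0\<^sub>v n)
      \<and> x = vec_sum n hs 2"
    then have hs01: "hs 0 \<in> H0" "hs 1 \<in> H1"
      using hs[THEN conjunct1, rule_format, of 0] hs[THEN conjunct1, rule_format, of 1] by simp_all
    then have "hs 0 + hs 1 = a + b"
      using hs x vec_sum_2[of hs] H1_carrier by auto
    then have "hs 0 = a \<and> hs 1 = b"
      using subspace_decomposition_unique[OF H0 H1 trivial a _ b] hs01 by blast
    then show "hs = ?hs"
      using hs by (auto simp: fun_eq_iff not_less less_2_cases_iff)
  next
    have "vec_sum n ?hs 2 = a + b"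
      using vec_sum_2[of ?hs] b H1_carrier by (simp add: subset_iff)
    then show "(\<forall>i<2. ?hs i \<in> (if i = 0 then H0 else H1)) \<and> (\<forall>i. 2 \<le> i \<longrightarrow> ?hs i = 0\<^sub>v n)
      \<and> x = vec_sum n ?hs 2"
      using a b x by (auto simp: less_2_cases_iff)
  qed
qed

lemma is_direct_sum_vec_lines_dim_2:
  fixes u w :: "'a::field vec"
  defines "u \<equiv> vec 2 (\<lambda>i. if i = 0 then 1 else 0)" and "w \<equiv> vec 2 (\<lambda>i. 1)"
  shows "is_direct_sum 2 2 (\<lambda>i. if i = 0 then vec_line u else vec_line w)"
proof (rule is_direct_sum_2I)
  have carrier: "u \<in> carrier_vec 2" "w \<in> carrier_vec 2"
    by (simp_all add: u_def w_def)
  then show "is_subspace 2 (vec_line u)" "is_subspace 2 (vec_line w)"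
    by (simp_all add: is_subspace_vec_line)
  show "vec_line u \<inter> vec_line w \<subseteq> {0\<^sub>v 2}"
  proof
    fix x assume "x \<in> vec_line u \<inter> vec_line w"
    then obtain a b where x: "x = a \<cdot>\<^sub>v u" "x = b \<cdot>\<^sub>v w"
      unfolding vec_line_def by blast
    then have "(a \<cdot>\<^sub>v u) $ 1 = (b \<cdot>\<^sub>v w) $ 1" by simp
    then have "b = 0" by (simp add: u_def w_def)
    then show "x \<in> {0\<^sub>v 2}"
      using x carrier by auto
  qed
  show "\<forall>x\<in>carrier_vec 2. \<exists>a\<in>vec_line u. \<exists>b\<in>vec_line w. x = a + b"
  proof
    fix x :: "'a vec" assume "x \<in> carrier_vec 2"
    then have "x = (x $ 0 - x $ 1) \<cdot>\<^sub>v u + x $ 1 \<cdot>\<^sub>v w"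
      by (auto simp: u_def w_def vec_eq_iff less_2_cases_iff)
    then show "\<exists>a\<in>vec_line u. \<exists>b\<in>vec_line w. x = a + b"
      by (auto simp: vec_line_def)
  qed
qed

lemma cscalar_prod_dim_2:
  assumes "x \<in> carrier_vec 2" "y \<in> carrier_vec 2"
  shows "x \<bullet>c y = x $ 0 * conjugate (y $ 0) + x $ 1 * conjugate (y $ 1)"
  using assms by (simp add: scalar_prod_def numeral_2_eq_2)

lemma exists_mp_inverse_not_blockwise:
  "\<exists>(n::nat) (g::'k::conjugatable_ordered_field vec \<Rightarrow> 'k vec \<Rightarrow> 'k) (A::'k mat) (m::nat)
      (H::nat \<Rightarrow> 'k vec set) (Fplus::'k mat) (Fdag::'k mat).
     inner_prod_on n g \<and> A \<in> carrier_mat n n \<and>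
     (\<forall>i<m. is_subspace n (H i) \<and> invariant_under A (H i)) \<and> is_direct_sum n m H \<and>
     Fplus \<in> carrier_mat n n \<and>
     (\<forall>i<m. is_mp_inverse n g (H i) ((*\<^sub>v) A) ((*\<^sub>v) Fplus)) \<and>
     Fdag \<in> carrier_mat n n \<and>
     is_mp_inverse n g (carrier_vec n) ((*\<^sub>v) A) ((*\<^sub>v) Fdag) \<and>
     Fplus \<noteq> Fdag"
proof -
  define u :: "'k vec" where "u = vec 2 (\<lambda>i. if i = 0 then 1 else 0)"
  define v :: "'k vec" where "v = vec 2 (\<lambda>i. if i = 0 then 1 else -1)"
  define w :: "'k vec" where "w = vec 2 (\<lambda>i. 1)"
  define A where "A = rank_one_mat 2 u v"
  define D where "D = rank_one_mat 2 ((1 / ((u \<bullet>c u) * (v \<bullet>c v))) \<cdot>\<^sub>v v) u"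
  define H where "H i = (if i = 0 then vec_line u else vec_line w)" for i :: nat
  have carrier: "u \<in> carrier_vec 2" "v \<in> carrier_vec 2" "w \<in> carrier_vec 2"
    by (simp_all add: u_def v_def w_def)
  have A_carrier: "A \<in> carrier_mat 2 2" and D_carrier: "D \<in> carrier_mat 2 2"
    by (simp_all add: A_def D_def)
  have Au: "A *\<^sub>v u = 1 \<cdot>\<^sub>v u" and Aw: "A *\<^sub>v w = 0 \<cdot>\<^sub>v w"
    using carrier by (simp_all add: A_def rank_one_mat_mult_vec cscalar_prod_dim_2 conjugate_neg)
      (simp_all add: u_def v_def w_def vec_eq_iff conjugate_neg)
  have subspaces: "is_subspace 2 (vec_line u)" "is_subspace 2 (vec_line w)"
    using carrier by (simp_all add: is_subspace_vec_line)
  have A_on_H0: "\<forall>x\<in>vec_line u. A *\<^sub>v x = x"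
    using mult_mat_vec_vec_line[OF A_carrier carrier(1) Au] by simp
  have A_on_H1: "\<forall>x\<in>vec_line w. A *\<^sub>v x = 0\<^sub>v 2"
    using mult_mat_vec_vec_line[OF A_carrier carrier(3) Aw] subspaces(2)
    by (auto simp: is_subspace_def)
  have "invariant_under A (vec_line u)" "invariant_under A (vec_line w)"
    using A_on_H0 A_on_H1 subspaces by (simp_all add: invariant_under_def is_subspace_def)
  then have blocks: "\<forall>i<2. is_subspace 2 (H i) \<and> invariant_under A (H i)"
    using subspaces by (simp add: H_def)
  have "is_direct_sum 2 2 H"
    unfolding H_def[abs_def] u_def w_def by (rule is_direct_sum_vec_lines_dim_2)
  have "is_mp_inverse 2 (\<bullet>c) (vec_line u) ((*\<^sub>v) A) ((*\<^sub>v) A)"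
    using is_mp_inverse_self_if_identity_on inner_prod_on_cscalar_prod subspaces A_on_H0 by blast
  moreover have "is_mp_inverse 2 (\<bullet>c) (vec_line w) ((*\<^sub>v) A) ((*\<^sub>v) A)"
    using is_mp_inverse_if_zero_on inner_prod_on_cscalar_prod subspaces A_on_H1 by blast
  ultimately have "\<forall>i<2. is_mp_inverse 2 (\<bullet>c) (H i) ((*\<^sub>v) A) ((*\<^sub>v) A)"
    by (simp add: H_def)
  moreover have "is_mp_inverse 2 (\<bullet>c) (carrier_vec 2) ((*\<^sub>v) A) ((*\<^sub>v) D)"
    unfolding A_def D_def
    by (rule is_mp_inverse_rank_one_mat) (auto simp: u_def v_def vec_eq_iff)
  moreover have "A $$ (0, 1) \<noteq> D $$ (0, 1)"
    by (simp add: A_def D_def rank_one_mat_def u_def v_def)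
  ultimately show ?thesis
    using inner_prod_on_cscalar_prod A_carrier D_carrier blocks \<open>is_direct_sum 2 2 H\<close>
    by (intro exI[of _ 2] exI[of _ "(\<bullet>c)"] exI[of _ A] exI[of _ 2] exI[of _ H] exI[of _ A] exI[of _ D])
      auto
qed

theorem corollary3p5:
  shows "(\<exists>(n::nat) (g::real vec \<Rightarrow> real vec \<Rightarrow> real) (A::real mat) (m::nat) (H::nat \<Rightarrow> real vec set)
            (Fplus::real mat) (Fdag::real mat).
           inner_prod_on n g \<and> A \<in> carrier_mat n n \<and>
           (\<forall>i<m. is_subspace n (H i) \<and> invariant_under A (H i)) \<and> is_direct_sum n m H \<and>
           Fplus \<in> carrier_mat n n \<and>
           (\<forall>i<m. is_mp_inverse n g (H i) ((*\<^sub>v) A) ((*\<^sub>v) Fplus)) \<and>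
           Fdag \<in> carrier_mat n n \<and>
           is_mp_inverse n g (carrier_vec n) ((*\<^sub>v) A) ((*\<^sub>v) Fdag) \<and>
           Fplus \<noteq> Fdag)
       \<and>
       (\<exists>(n::nat) (g::complex vec \<Rightarrow> complex vec \<Rightarrow> complex) (A::complex mat) (m::nat) (H::nat \<Rightarrow> complex vec set)
            (Fplus::complex mat) (Fdag::complex mat).
           inner_prod_on n g \<and> A \<in> carrier_mat n n \<and>
           (\<forall>i<m. is_subspace n (H i) \<and> invariant_under A (H i)) \<and> is_direct_sum n m H \<and>
           Fplus \<in> carrier_mat n n \<and>
           (\<forall>i<m. is_mp_inverse n g (H i) ((*\<^sub>v) A) ((*\<^sub>v) Fplus)) \<and>
           Fdag \<in> carrier_mat n n \<and>
           is_mp_inverse n g (carrier_vec n) ((*\<^sub>v) A) ((*\<^sub>v) Fdag) \<and>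
           Fplus \<noteq> Fdag)"
  by (intro conjI exists_mp_inverse_not_blockwise)

end
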